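(* Let $(b_1,b_2,\ldots)$ be a sequence of real numbers. There exist real numbers $w_{n,s}$ ($n,s\in\mathbb{N}_0$, $s\ge n$), depending only on $(b_n)$, which satisfy the Goursat problem $$w_{n,t+1}+w_{n,t-1}-w_{n+1,t}-w_{n-1,t}+b_nw_{n,t}=0,\qquad n\in\mathbb{N},\ t\in\mathbb{N}_0,\ t>n,$$ $$w_{n,n}=-\sum_{k=1}^nb_k,\quad n\in\mathbb{N},\qquad\qquad w_{0,t}=0,\quad t\in\mathbb{N}_0,$$ and such that for every real sequence $f=(f_0,f_1,\ldots)$ the solution $u^f_{n,t}$ of $$u_{n,t+1}+u_{n,t-1}-u_{n+1,t}-u_{n-1,t}+b_nu_{n,t}=0\quad (n\in\mathbb{N},\ t\in\mathbb{N}_0),$$ $$u_{n,-1}=u_{n,0}=0\ (n\in\mathbb{N}),\qquad u_{0,t}=f_t\ (t\in\mathbb{N}_0)$$ admits the representation $$u^f_{n,t}=f_{t-n}+\sum_{s=n}^{t-1}w_{n,s}f_{t-s-1},\qquad n,t\in\mathbb{N}_0 .$$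
   Context: $\mathbb{N}=\{1,2,\ldots\}$, $\mathbb{N}_0=\mathbb{N}\cup\{0\}$. Conventions: $f_k=0$ for $k<0$, and a sum whose lower limit exceeds its upper limit is $0$. *)

theory Defs
  imports Complex_Main
begin

definition extend_zero :: "(nat \<Rightarrow> real) \<Rightarrow> int \<Rightarrow> real" where
  "extend_zero f k = (if k < 0 then 0 else f (nat k))"

(* Sequences (b_1, b_2, ...) are total functions on nat; b 0 is never used.
   In the recursion n >= 1 and t > n, so n - 1 and t - 1 are not truncated
   and w is never evaluated at a pair (n, s) with s < n. *)
definition goursat_solution ::
    "(nat \<Rightarrow> real) \<Rightarrow> (nat \<Rightarrow> nat \<Rightarrow> real) \<Rightarrow> bool" where
  "goursat_solution b w \<longleftrightarrow>
     (\<forall>n\<ge>1. \<forall>t>n. w n (t + 1) + w n (t - 1) - w (n + 1) t - w (n - 1) t + b n * w n t = 0) \<and>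
     (\<forall>n\<ge>1. w n n = - (\<Sum>k = 1..n. b k)) \<and>
     (\<forall>t. w 0 t = 0)"

(* The time index is an int because of the initial time t = -1; only values at
   times t >= -1 matter. *)
definition dynamical_solution ::
    "(nat \<Rightarrow> real) \<Rightarrow> (nat \<Rightarrow> real) \<Rightarrow> (nat \<Rightarrow> int \<Rightarrow> real) \<Rightarrow> bool" where
  "dynamical_solution b f u \<longleftrightarrow>
     (\<forall>n\<ge>1. \<forall>t\<ge>0. u n (t + 1) + u n (t - 1) - u (n + 1) t - u (n - 1) t + b n * u n t = 0) \<and>
     (\<forall>n\<ge>1. u n (-1) = 0 \<and> u n 0 = 0) \<and>
     (\<forall>t. u 0 (int t) = f t)"

end

theory Submission
  imports Defs
begin

text \<open>
  The forced problem is linear and invariant under time shifts, so every solution is a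
  superposition of delayed copies of a single one: the response \<open>G\<close> to the unit impulse
  \<open>f = (1, 0, 0, \<dots>)\<close>, extended by zero to negative times. Thus \<open>u\<^sub>n\<^sub>,\<^sub>t\<close> is the convolution of
  \<open>f\<close> with \<open>G\<^sub>n\<close> (lemmas \<open>dynamical_solution_superposition\<close> and \<open>dynamical_solution_unique\<close>).

  Signals travel at most one site per time step. Hence \<open>G\<^sub>n\<^sub>,\<^sub>k\<close> vanishes for \<open>k < n\<close>, and the
  wave front carries the impulse undamped, \<open>G\<^sub>n\<^sub>,\<^sub>n = 1\<close>. Splitting off the front from the
  convolution leaves the term \<open>f\<^sub>t\<^sub>-\<^sub>n\<close> and a sum with kernel \<open>w\<^sub>n\<^sub>,\<^sub>s = G\<^sub>n\<^sub>,\<^sub>s\<^sub>+\<^sub>1\<close>. This kernel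
  satisfies the difference equation because \<open>G\<close> does, and its diagonal records what the
  potential removes just behind the front: passing site \<open>n\<close> contributes \<open>- b\<^sub>n\<close>.
\<close>

text \<open>
  The first argument is the time shifted by one, so that the recursion starts from the rest
  state at time \<open>-1\<close> and the impulse applied to site \<open>0\<close> at time \<open>0\<close>.
\<close>

fun impulse_steps :: "(nat \<Rightarrow> real) \<Rightarrow> nat \<Rightarrow> nat \<Rightarrow> real" where
  "impulse_steps b 0 n = 0"
| "impulse_steps b (Suc 0) n = (if n = 0 then 1 else 0)"
| "impulse_steps b (Suc (Suc t)) n =
     (if n = 0 then 0
      else impulse_steps b (Suc t) (n + 1) + impulse_steps b (Suc t) (n - 1)
        - b n * impulse_steps b (Suc t) n - impulse_steps b t n)"

definition impulse_response :: "(nat \<Rightarrow> real) \<Rightarrow> nat \<Rightarrow> int \<Rightarrow> real" where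
  "impulse_response b n k = impulse_steps b (nat (k + 1)) n"

lemma impulse_response_negative: "k < 0 \<Longrightarrow> impulse_response b n k = 0"
  by (simp add: impulse_response_def)

lemma impulse_response_time_0: "impulse_response b n 0 = (if n = 0 then 1 else 0)"
  by (simp add: impulse_response_def)

lemma impulse_response_site_0: "impulse_response b 0 k = (if k = 0 then 1 else 0)"
proof (cases "k \<le> 0")
  case True
  then show ?thesis
    using impulse_response_negative impulse_response_time_0 by force
next
  case False
  then have "nat (k + 1) = Suc (Suc (nat (k - 1)))" by simp
  with False show ?thesis by (simp add: impulse_response_def)
qed

text \<open>
  Extension by zero makes the equation hold at all times, negative ones included. A delayed
  copy of the response therefore solves it as well, without case distinctions at the delay.
\<close>

lemma impulse_response_equation:
  assumes "n \<ge> 1"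
  shows "impulse_response b n (k + 1) + impulse_response b n (k - 1)
    - impulse_response b (n + 1) k - impulse_response b (n - 1) k
    + b n * impulse_response b n k = 0"
proof (cases "k < 0")
  case True
  with assms show ?thesis
    using impulse_response_time_0[of b n]
    by (cases "k = - 1") (simp_all add: impulse_response_negative)
next
  case False
  then have "nat (k + 1 + 1) = Suc (Suc (nat k))" "nat (k - 1 + 1) = nat k"
    "nat (k + 1) = Suc (nat k)" by simp_all
  with assms show ?thesis by (simp add: impulse_response_def)
qed

text \<open>Finite speed of propagation: one time step carries a signal by at most one site.\<close>

lemma impulse_steps_before_front: "t \<le> n \<Longrightarrow> impulse_steps b t n = 0"
  by (induction b t n rule: impulse_steps.induct) auto

lemma impulse_steps_on_front: "impulse_steps b (Suc n) n = 1"
proof (induction n)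
  case (Suc n)
  then show ?case by (simp add: impulse_steps_before_front)
qed simp

text \<open>
  At the site reached by the front the potential acts on the value \<open>1\<close>; everything that
  could come back from sites further out still vanishes.
\<close>

lemma impulse_steps_behind_front:
  "impulse_steps b (Suc (Suc n)) n = - (\<Sum>k = 1..n. b k)"
proof (induction n)
  case (Suc n)
  have "impulse_steps b (Suc (Suc (Suc n))) (Suc n)
      = impulse_steps b (Suc (Suc n)) n - b (Suc n)"
    using impulse_steps.simps(3)[of b "Suc n" "Suc n"]
    by (simp add: impulse_steps_before_front impulse_steps_on_front
        del: impulse_steps.simps)
  then show ?case using Suc.IH by simp
qed simp

definition superposition :: "(nat \<Rightarrow> real) \<Rightarrow> (nat \<Rightarrow> real) \<Rightarrow> nat \<Rightarrow> int \<Rightarrow> real" where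
  "superposition b f n t = (\<Sum>j\<le>nat t. f j * impulse_response b n (t - int j))"

text \<open>
  Impulses released after time \<open>t\<close> have no effect yet. Values at several times can thus be
  written as sums over one common range and combined term by term.
\<close>

lemma superposition_extend_range:
  assumes "nat t \<le> m"
  shows "superposition b f n t = (\<Sum>j\<le>m. f j * impulse_response b n (t - int j))"
  unfolding superposition_def
  by (rule sum.mono_neutral_left) (use assms in \<open>auto simp: impulse_response_negative\<close>)

lemma dynamical_solution_superposition: "dynamical_solution b f (superposition b f)"
proof -
  have "superposition b f n (t + 1) + superposition b f n (t - 1)
      - superposition b f (n + 1) t - superposition b f (n - 1) t
      + b n * superposition b f n t = 0" if "n \<ge> 1" "t \<ge> 0" for n t
  proof -
    define m where "m = nat (t + 1)"
    have range: "superposition b f i s = (\<Sum>j\<le>m. f j * impulse_response b i (s - int j))"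
      if "s \<le> t + 1" for i s
      using that by (intro superposition_extend_range) (simp add: m_def)
    let ?G = "impulse_response b"
    have "superposition b f n (t + 1) + superposition b f n (t - 1)
        - superposition b f (n + 1) t - superposition b f (n - 1) t
        + b n * superposition b f n t
        = (\<Sum>j\<le>m. f j * (?G n (t - int j + 1) + ?G n (t - int j - 1)
            - ?G (n + 1) (t - int j) - ?G (n - 1) (t - int j) + b n * ?G n (t - int j)))"
      by (simp add: range sum.distrib sum_subtractf sum_distrib_left algebra_simps)
    also have "\<dots> = 0"
      by (simp only: impulse_response_equation[OF that(1)]) simp
    finally show ?thesis .
  qed
  moreover have "superposition b f n (- 1) = 0 \<and> superposition b f n 0 = 0" if "n \<ge> 1" for n
    using that
    by (simp add: superposition_def impulse_response_negative impulse_response_time_0)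
  moreover have "superposition b f 0 (int t) = f t" for t
  proof -
    have "superposition b f 0 (int t) = (\<Sum>j\<le>t. if j = t then f j else 0)"
      unfolding superposition_def
      by (intro sum.cong) (auto simp: impulse_response_site_0)
    then show ?thesis by simp
  qed
  ultimately show ?thesis
    unfolding dynamical_solution_def by blast
qed

lemma dynamical_solution_unique:
  assumes u: "dynamical_solution b f u" and v: "dynamical_solution b f v"
  shows "u n (int t) = v n (int t)"
proof -
  have step: "x n (t + 1) = x (n + 1) t + x (n - 1) t - b n * x n t - x n (t - 1)"
    if "dynamical_solution b f x" "n \<ge> 1" "t \<ge> 0" for x n t
    using that unfolding dynamical_solution_def by (smt (verit))
  have start: "x n (- 1) = 0" "x n 0 = 0" if "dynamical_solution b f x" "n \<ge> 1" for x n
    using that unfolding dynamical_solution_def by auto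
  have boundary: "x 0 (int t) = f t" if "dynamical_solution b f x" for x t
    using that unfolding dynamical_solution_def by blast
  \<comment> \<open>The equation has second order in time, so two consecutive times are carried along. The
    earlier one leaves out site \<open>0\<close>, where nothing is prescribed at time \<open>-1\<close>.\<close>
  have "(\<forall>n. u n (int t) = v n (int t)) \<and> (\<forall>n\<ge>1. u n (int t - 1) = v n (int t - 1))"
  proof (induction t)
    case 0
    have "u n 0 = v n 0" for n
      using start(2)[OF u, of n] start(2)[OF v, of n] boundary[OF u, of 0] boundary[OF v, of 0]
      by (cases "n = 0") auto
    then show ?case using start(1)[OF u] start(1)[OF v] by simp
  next
    case (Suc t)
    have "u n (int (Suc t)) = v n (int (Suc t))" for n
    proof (cases "n = 0")
      case True
      then show ?thesis by (simp only: boundary[OF u] boundary[OF v])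
    next
      case False
      then have "n \<ge> 1" by simp
      then have "u n (int t + 1) = v n (int t + 1)"
        using Suc.IH by (simp add: step[OF u] step[OF v])
      then show ?thesis by (simp add: add.commute)
    qed
    then show ?case using Suc.IH by simp
  qed
  then show ?thesis by blast
qed

lemma superposition_split_front:
  "superposition b f n (int t) = extend_zero f (int t - int n) +
    (\<Sum>s = n..<t. impulse_steps b (s + 2) n * extend_zero f (int t - int s - 1))"
proof -
  let ?h = "\<lambda>k. impulse_steps b (Suc k) n * extend_zero f (int t - int k)"
  have shift: "nat (int t - int j + 1) = Suc (t - j)" if "j \<le> t" for j
    using that by simp
  have "superposition b f n (int t) = (\<Sum>k\<le>t. ?h k)"
    unfolding superposition_def
    by (rule sum.reindex_bij_witness[of _ "\<lambda>k. t - k" "\<lambda>j. t - j"])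
      (auto simp: impulse_response_def extend_zero_def of_nat_diff shift)
  also have "\<dots> = (\<Sum>k \<in> {n..t}. ?h k)"
    by (rule sum.mono_neutral_right) (auto simp: impulse_steps_before_front)
  also have "\<dots> = extend_zero f (int t - int n)
      + (\<Sum>s = n..<t. impulse_steps b (s + 2) n * extend_zero f (int t - int s - 1))"
  proof (cases "n \<le> t")
    case True
    then have "(\<Sum>k \<in> {n..t}. ?h k) = ?h n + (\<Sum>s = n..<t. ?h (Suc s))"
      by (simp only: atLeastLessThanSuc_atLeastAtMost[symmetric] less_Suc_eq_le
          sum.atLeast_Suc_lessThan sum.shift_bounds_Suc_ivl)
    then show ?thesis
      by (simp add: impulse_steps_on_front algebra_simps del: impulse_steps.simps)
  next
    case False
    then show ?thesis by (simp add: extend_zero_def)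
  qed
  finally show ?thesis .
qed

lemma goursat_solution_impulse_steps:
  "goursat_solution b (\<lambda>n s. impulse_steps b (s + 2) n)"
proof -
  have "impulse_steps b (t + 1 + 2) n + impulse_steps b (t - 1 + 2) n
      - impulse_steps b (t + 2) (n + 1) - impulse_steps b (t + 2) (n - 1)
      + b n * impulse_steps b (t + 2) n = 0" if "n \<ge> 1" "t > n" for n t
  proof -
    have "t + 1 + 2 = Suc (Suc (Suc t))" "t - 1 + 2 = Suc t" "t + 2 = Suc (Suc t)"
      using that by simp_all
    then show ?thesis
      using that impulse_steps.simps(3)[of b "Suc t" n] by (simp del: impulse_steps.simps)
  qed
  moreover have "impulse_steps b (n + 2) n = - (\<Sum>k = 1..n. b k)" for n
    using impulse_steps_behind_front by simp
  moreover have "impulse_steps b (t + 2) 0 = 0" for t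
    by simp
  ultimately show ?thesis
    unfolding goursat_solution_def by blast
qed

theorem lemma1:
  fixes b :: "nat \<Rightarrow> real"
  shows "\<exists>w :: nat \<Rightarrow> nat \<Rightarrow> real. goursat_solution b w \<and>
    (\<forall>f :: nat \<Rightarrow> real.
      (\<exists>u. dynamical_solution b f u) \<and>
      (\<forall>u. dynamical_solution b f u \<longrightarrow>
        (\<forall>n t :: nat. u n (int t) = extend_zero f (int t - int n) +
          (\<Sum>s = n..<t. w n s * extend_zero f (int t - int s - 1)))))"
proof (intro exI[of _ "\<lambda>n s. impulse_steps b (s + 2) n"] conjI allI impI)
  show "goursat_solution b (\<lambda>n s. impulse_steps b (s + 2) n)"
    by (rule goursat_solution_impulse_steps)
  show "\<exists>u. dynamical_solution b f u" for f
    using dynamical_solution_superposition by blast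
  show "u n (int t) = extend_zero f (int t - int n) +
      (\<Sum>s = n..<t. impulse_steps b (s + 2) n * extend_zero f (int t - int s - 1))"
    if "dynamical_solution b f u" for f u n t
    using dynamical_solution_unique[OF that dynamical_solution_superposition]
      superposition_split_front by simp
qed

end
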